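(* Let $R$ be a commutative local ring, and let $A\in M_2(R)$. If $A$ is strongly $P$-clean, then either $A\in M_2(P(R))$, or $I_2-A\in M_2(P(R))$, or $\operatorname{tr}(A)\in 1+P(R)$ and $\operatorname{tr}(A)^2-4\det(A)=u^2$ for some $u\in 1+P(R)$.
   Context: Rings are associative with identity. $P(S)$ denotes the prime radical of a ring $S$ (the intersection of all prime ideals of $S$). $M_2(R)$ is the ring of $2\times2$ matrices over $R$ and $M_2(P(R))$ is the set of those with all entries in $P(R)$. An element $a$ of a ring $S$ is strongly $P$-clean if $a=e+w$ with $e=e^2\in S$, $w\in P(S)$ and $ew=we$; here this is applied with $S=M_2(R)$. *)

theory Defs
  imports "HOL-Analysis.Determinants" "HOL-Algebra.Ideal_Product"
begin

text \<open>
  The library's \<open>primeideal\<close> is restricted to commutative rings; matrix rings need the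
  noncommutative notion, phrased with products of two-sided ideals.
\<close>

definition prime_two_sided_ideal :: "'a set \<Rightarrow> ('a, 'b) ring_scheme \<Rightarrow> bool" where
  "prime_two_sided_ideal P S \<longleftrightarrow>
     ideal P S \<and> P \<noteq> carrier S \<and>
     (\<forall>I J. ideal I S \<longrightarrow> ideal J S \<longrightarrow> ideal_prod S I J \<subseteq> P \<longrightarrow> I \<subseteq> P \<or> J \<subseteq> P)"

definition prime_radical :: "('a, 'b) ring_scheme \<Rightarrow> 'a set" where
  "prime_radical S = carrier S \<inter> \<Inter>{P. prime_two_sided_ideal P S}"

definition strongly_P_clean :: "('a, 'b) ring_scheme \<Rightarrow> 'a \<Rightarrow> bool" where
  "strongly_P_clean S a \<longleftrightarrow>
     (\<exists>e \<in> carrier S. \<exists>w \<in> prime_radical S.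
        e \<otimes>\<^bsub>S\<^esub> e = e \<and> e \<otimes>\<^bsub>S\<^esub> w = w \<otimes>\<^bsub>S\<^esub> e \<and> a = e \<oplus>\<^bsub>S\<^esub> w)"

definition commutative_local_ring :: "('a, 'b) ring_scheme \<Rightarrow> bool" where
  "commutative_local_ring S \<longleftrightarrow> cring S \<and> (\<exists>!M. maximalideal M S)"

definition type_ring :: "'a::comm_ring_1 ring" where
  "type_ring = \<lparr>carrier = UNIV, mult = (*), one = 1, zero = 0, add = (+)\<rparr>"

text \<open>
  The type-class multiplication on \<open>'a^2^2\<close> is componentwise, so the matrix ring has to be
  given explicitly.
\<close>

definition M2_ring :: "('a::comm_ring_1^2^2) ring" where
  "M2_ring = \<lparr>carrier = UNIV, mult = (**), one = mat 1, zero = 0, add = (+)\<rparr>"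

definition M2_over :: "'a set \<Rightarrow> ('a^2^2) set" where
  "M2_over X = {B. \<forall>i j. B $ i $ j \<in> X}"

lemma cring_type_ring: "cring (type_ring :: 'a::comm_ring_1 ring)"
proof (rule cringI)
  show "abelian_group (type_ring :: 'a ring)"
  proof (rule abelian_groupI)
    fix x :: 'a
    show "\<exists>y \<in> carrier type_ring. y \<oplus>\<^bsub>type_ring\<^esub> x = \<zero>\<^bsub>type_ring\<^esub>"
      by (auto simp: type_ring_def intro!: exI[of _ "- x"])
  qed (auto simp: type_ring_def algebra_simps)
  show "Group.comm_monoid (type_ring :: 'a ring)"
    by (rule comm_monoidI) (auto simp: type_ring_def algebra_simps)
qed (auto simp: type_ring_def algebra_simps)

lemma ring_M2_ring: "ring (M2_ring :: ('a::comm_ring_1^2^2) ring)"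
proof (rule ringI)
  show "abelian_group (M2_ring :: ('a^2^2) ring)"
  proof (rule abelian_groupI)
    fix x :: "'a^2^2"
    show "\<exists>y \<in> carrier M2_ring. y \<oplus>\<^bsub>M2_ring\<^esub> x = \<zero>\<^bsub>M2_ring\<^esub>"
      by (auto simp: M2_ring_def intro!: exI[of _ "- x"])
  qed (auto simp: M2_ring_def algebra_simps)
  show "Group.monoid (M2_ring :: ('a^2^2) ring)"
    by (rule monoidI) (auto simp: M2_ring_def matrix_mul_assoc)
qed (auto simp: M2_ring_def vec_eq_iff matrix_matrix_mult_def sum.distrib algebra_simps)

end

theory Submission
  imports Defs "HOL-Algebra.Ring_Divisibility"
begin

text \<open>
  If \<open>Q\<close> is a prime ideal of \<open>R\<close>, then \<open>M\<^sub>2(Q)\<close> is a prime ideal of \<open>M\<^sub>2(R)\<close>, so the prime radical of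
  \<open>M\<^sub>2(R)\<close> lies in \<open>M\<^sub>2(P(R))\<close>. Write \<open>A = E + W\<close> with \<open>E\<close> idempotent and \<open>W\<close> in the radical. A local ring
  has only the idempotents \<open>0\<close> and \<open>1\<close>, which by Cayley-Hamilton leaves \<open>E = 0\<close>, \<open>E = I\<close>, or trace \<open>1\<close> and
  determinant \<open>0\<close>. In the last case \<open>E\<close> is a rank-one projection commuting with \<open>A\<close>, and
  \<open>u = tr ((2E - I) A)\<close> is the difference of the eigenvalues of \<open>A\<close> on its image and kernel.
\<close>

section \<open>Maximal ideals and elementwise descriptions of ideals\<close>

text \<open>Zorn's lemma applies once properness is expressed as omitting \<open>\<one>\<close>, a
  condition that passes to unions of chains.\<close>

lemma (in ring) exists_maximalideal_superset:
  assumes "ideal I R" "I \<noteq> carrier R"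
  shows "\<exists>M. maximalideal M R \<and> I \<subseteq> M"
proof -
  let ?F = "{J. ideal J R \<and> I \<subseteq> J \<and> \<one> \<notin> J}"
  have "\<exists>M\<in>?F. \<forall>J\<in>?F. M \<subseteq> J \<longrightarrow> J = M"
  proof (rule subset_Zorn_nonempty)
    show "?F \<noteq> {}"
      using assms ideal.one_imp_carrier by blast
  next
    fix C assume C: "C \<noteq> {}" "subset.chain ?F C"
    then have "subset.chain {J. ideal J R} C"
      unfolding subset.chain_def by auto
    then have "ideal (\<Union>C) R"
      using chain_Union_is_ideal[of C] C(1) by simp
    moreover have "C \<subseteq> ?F"
      using C(2) unfolding subset.chain_def by blast
    then have "I \<subseteq> \<Union>C" "\<one> \<notin> \<Union>C"
      using C(1) by blast+
    ultimately show "\<Union>C \<in> ?F" by simp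
  qed
  then obtain M where M: "ideal M R" "I \<subseteq> M" "\<one> \<notin> M"
    and max: "\<forall>J\<in>?F. M \<subseteq> J \<longrightarrow> J = M"
    by auto
  have "maximalideal M R"
  proof (rule maximalidealI)
    show "carrier R \<noteq> M" using M(3) by auto
    show "J = M \<or> J = carrier R" if "ideal J R" "M \<subseteq> J" for J
    proof (cases "\<one> \<in> J")
      case True
      then show ?thesis using ideal.one_imp_carrier that(1) by blast
    next
      case False
      then show ?thesis using max M(2) that by auto
    qed
  qed (fact M(1))
  with M(2) show ?thesis by blast
qed

text \<open>Closure under additive inverses comes from multiplying by \<open>- 1\<close>, and
  commutativity turns left multiples into right ones.\<close>

lemma ideal_type_ring_iff:
  "ideal I (type_ring :: 'a::comm_ring_1 ring) \<longleftrightarrow>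
     0 \<in> I \<and> (\<forall>x\<in>I. \<forall>y\<in>I. x + y \<in> I) \<and> (\<forall>x\<in>I. \<forall>r. r * x \<in> I)"
  (is "?L \<longleftrightarrow> ?R")
proof
  assume ?L
  then interpret ideal I "type_ring :: 'a ring" .
  show ?R
    using additive_subgroup.zero_closed[OF is_additive_subgroup]
      additive_subgroup.a_closed[OF is_additive_subgroup] I_l_closed
    by (simp add: type_ring_def)
next
  assume R: ?R
  have "- x \<in> I" if "x \<in> I" for x
    using R that by (metis mult_minus1)
  moreover have "inv\<^bsub>add_monoid (type_ring :: 'a ring)\<^esub> x = - x" for x
    using abelian_group.minus_equality[OF ring.is_abelian_group[OF cring.axioms(1)[OF cring_type_ring]], of "- x" x]
    by (simp add: a_inv_def type_ring_def)
  ultimately show ?L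
    using R
    by (intro idealI cring.axioms(1)[OF cring_type_ring] subgroup.intro)
      (auto simp: type_ring_def mult.commute)
qed

lemma ideal_range_mult_type_ring: "ideal (range (\<lambda>r. r * z)) (type_ring :: 'a::comm_ring_1 ring)"
  unfolding ideal_type_ring_iff
  by (auto simp: image_iff distrib_right[symmetric] mult.assoc[symmetric] intro: exI[of _ 0])

lemma ideal_M2_ring_iff:
  "ideal I (M2_ring :: ('a::comm_ring_1^2^2) ring) \<longleftrightarrow>
     0 \<in> I \<and> (\<forall>x\<in>I. \<forall>y\<in>I. x + y \<in> I) \<and> (\<forall>x\<in>I. \<forall>r. r ** x \<in> I \<and> x ** r \<in> I)"
  (is "?L \<longleftrightarrow> ?R")
proof
  assume ?L
  then interpret ideal I "M2_ring :: ('a^2^2) ring" .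
  show ?R
    using additive_subgroup.zero_closed[OF is_additive_subgroup]
      additive_subgroup.a_closed[OF is_additive_subgroup] I_l_closed I_r_closed
    by (simp add: M2_ring_def)
next
  assume R: ?R
  have "- mat 1 ** x = - x" for x :: "'a^2^2"
    by (simp add: vec_eq_iff matrix_matrix_mult_def mat_def forall_2 sum_2)
  then have "- x \<in> I" if "x \<in> I" for x
    using R that by metis
  moreover have "inv\<^bsub>add_monoid (M2_ring :: ('a^2^2) ring)\<^esub> x = - x" for x
    using abelian_group.minus_equality[OF ring.is_abelian_group[OF ring_M2_ring], of "- x" x]
    by (simp add: a_inv_def M2_ring_def)
  ultimately show ?L
    using R by (intro idealI ring_M2_ring subgroup.intro) (auto simp: M2_ring_def)
qed

section \<open>Prime ideals and prime radicals\<close>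

text \<open>Idealwise primeness is tested on the principal ideals of \<open>x\<close> and
  \<open>y\<close>; by commutativity their product consists of multiples of
  \<open>x * y\<close>.\<close>

lemma prime_two_sided_ideal_type_ring_mult:
  assumes Q: "prime_two_sided_ideal Q (type_ring :: 'a::comm_ring_1 ring)" and xy: "x * y \<in> Q"
  shows "x \<in> Q \<or> y \<in> Q"
proof -
  have Qid: "ideal Q type_ring"
    using Q by (simp add: prime_two_sided_ideal_def)
  have "ideal_prod type_ring (range (\<lambda>r. r * x)) (range (\<lambda>r. r * y)) \<subseteq> Q"
  proof
    fix z assume "z \<in> ideal_prod type_ring (range (\<lambda>r. r * x)) (range (\<lambda>r. r * y))"
    then show "z \<in> Q"
    proof induction
      case (prod i j)
      then obtain r s where "i = r * x" "j = s * y" by auto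
      then have "i \<otimes>\<^bsub>type_ring\<^esub> j = (r * s) * (x * y)"
        by (simp add: type_ring_def mult_ac)
      then show ?case
        using Qid xy by (simp add: ideal_type_ring_iff)
    next
      case (sum s t)
      then show ?case
        using Qid by (simp add: ideal_type_ring_iff) (simp add: type_ring_def)
    qed
  qed
  then have "range (\<lambda>r. r * x) \<subseteq> Q \<or> range (\<lambda>r. r * y) \<subseteq> Q"
    using Q ideal_range_mult_type_ring unfolding prime_two_sided_ideal_def by blast
  then show ?thesis
    by (metis mult_1 rangeI subsetD)
qed

text \<open>If neither factor lies in \<open>M2_over Q\<close>, each contains a matrix with an entry
  outside \<open>Q\<close>. A matrix unit placed between these two matrices makes the product of the
  two entries an entry of an element of \<open>ideal_prod M2_ring I J\<close>, against the primeness
  of \<open>Q\<close>.\<close>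

lemma prime_two_sided_ideal_M2_over:
  assumes Q: "prime_two_sided_ideal Q (type_ring :: 'a::comm_ring_1 ring)"
  shows "prime_two_sided_ideal (M2_over Q) M2_ring"
  unfolding prime_two_sided_ideal_def
proof (intro conjI allI impI)
  have Qid: "ideal Q type_ring" and Qne: "Q \<noteq> UNIV"
    using Q by (auto simp: prime_two_sided_ideal_def type_ring_def)
  then have "x + y \<in> Q" "r * x \<in> Q" "x * r \<in> Q" "0 \<in> Q" if "x \<in> Q" "y \<in> Q" for x y r
    using that by (simp_all add: ideal_type_ring_iff mult.commute[of x r])
  then show "ideal (M2_over Q) M2_ring"
    unfolding ideal_M2_ring_iff M2_over_def using Qid
    by (simp add: matrix_matrix_mult_def sum_2 ideal_type_ring_iff)
  obtain q where "q \<notin> Q" using Qne by auto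
  then have "(\<chi> i j. q) \<notin> M2_over Q" by (simp add: M2_over_def)
  then show "M2_over Q \<noteq> carrier M2_ring" by (auto simp: M2_ring_def)
next
  fix I J
  assume I: "ideal I M2_ring" and J: "ideal J M2_ring" and IJ: "ideal_prod M2_ring I J \<subseteq> M2_over Q"
  show "I \<subseteq> M2_over Q \<or> J \<subseteq> M2_over Q"
  proof (rule ccontr)
    assume "\<not> ?thesis"
    then obtain B C i j k l where B: "B \<in> I" "B $ i $ j \<notin> Q" and C: "C \<in> J" "C $ k $ l \<notin> Q"
      unfolding M2_over_def subset_iff mem_Collect_eq by blast
    \<comment> \<open>The matrix unit at row \<open>j\<close>, column \<open>k\<close> selects
      column \<open>j\<close> of \<open>B\<close> and row \<open>k\<close> of
      \<open>C\<close>.\<close>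
    define U :: "'a^2^2" where "U = (\<chi> p q. if p = j \<and> q = k then 1 else 0)"
    have "B ** U \<in> I"
      using I B(1) by (simp add: ideal_M2_ring_iff)
    from ideal_prod.prod[OF this C(1), of M2_ring] IJ have "B ** U ** C \<in> M2_over Q"
      by (auto simp: M2_ring_def)
    moreover have "(B ** U ** C) $ i $ l = B $ i $ j * C $ k $ l"
      using exhaust_2[of j] exhaust_2[of k]
      by (auto simp: U_def matrix_matrix_mult_def sum_2)
    ultimately have "B $ i $ j * C $ k $ l \<in> Q"
      by (metis (mono_tags, lifting) M2_over_def mem_Collect_eq)
    with prime_two_sided_ideal_type_ring_mult[OF Q] B(2) C(2) show False by blast
  qed
qed

lemma prime_radical_M2_ring_subset:
  "prime_radical (M2_ring :: ('a::comm_ring_1^2^2) ring) \<subseteq> M2_over (prime_radical type_ring)"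
proof
  fix W :: "'a^2^2" assume W: "W \<in> prime_radical M2_ring"
  have "W $ i $ j \<in> Q" if "prime_two_sided_ideal Q type_ring" for Q i j
    using W prime_two_sided_ideal_M2_over[OF that] by (auto simp: prime_radical_def M2_over_def)
  then show "W \<in> M2_over (prime_radical type_ring)"
    by (simp add: prime_radical_def M2_over_def type_ring_def)
qed

lemma ideal_prime_radical_type_ring:
  "ideal (prime_radical type_ring) (type_ring :: 'a::comm_ring_1 ring)"
proof -
  have "ideal Q (type_ring :: 'a ring)" if "prime_two_sided_ideal Q type_ring" for Q
    using that by (simp add: prime_two_sided_ideal_def)
  then show ?thesis
    unfolding ideal_type_ring_iff by (auto simp: prime_radical_def) (simp_all add: type_ring_def)
qed

section \<open>Idempotents and discriminants of 2x2 matrices\<close>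

text \<open>If \<open>e\<close> is neither \<open>0\<close> nor \<open>1\<close>, then
  \<open>e\<close> and \<open>1 - e\<close> are zero divisors, hence nonunits, so both lie in the
  unique maximal ideal; but their sum is \<open>1\<close>.\<close>

lemma commutative_local_ring_idempotent:
  fixes e :: "'a::comm_ring_1"
  assumes loc: "commutative_local_ring (type_ring :: 'a ring)" and e: "e * e = e"
  shows "e = 0 \<or> e = 1"
proof (rule ccontr)
  assume ne: "\<not> ?thesis"
  interpret cring "type_ring :: 'a ring" by (rule cring_type_ring)
  \<comment> \<open>A zero divisor generates a proper ideal: \<open>1 = r * x\<close> would force
    \<open>y = r * (x * y) = 0\<close>.\<close>
  have in_max: "\<exists>M. maximalideal M type_ring \<and> x \<in> M" if "x * y = 0" "y \<noteq> 0" for x y :: 'a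
  proof -
    let ?I = "range (\<lambda>r. r * x)"
    have "1 \<notin> ?I"
    proof
      assume "1 \<in> ?I"
      then obtain r where "1 = r * x" by auto
      then have "y = r * (x * y)" by (metis mult.assoc mult_1)
      with that show False by simp
    qed
    then have "?I \<noteq> carrier type_ring" by (auto simp: type_ring_def)
    moreover have "x \<in> ?I" by (metis mult_1 rangeI)
    ultimately show ?thesis
      using exists_maximalideal_superset[OF ideal_range_mult_type_ring] by blast
  qed
  have "e * (1 - e) = 0" "(1 - e) * e = 0"
    using e by (simp_all add: algebra_simps)
  with in_max[of e "1 - e"] in_max[of "1 - e" e] ne
  obtain M N where M: "maximalideal M type_ring" "e \<in> M"
    and N: "maximalideal N type_ring" "1 - e \<in> N" by auto
  have "M = N" using loc M(1) N(1) by (auto simp: commutative_local_ring_def)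
  have id: "ideal M type_ring" using M(1) by (rule maximalideal.axioms(1))
  have "e + (1 - e) \<in> M"
    using id M(2) N(2) \<open>M = N\<close> unfolding ideal_type_ring_iff by blast
  then have "\<one>\<^bsub>type_ring\<^esub> \<in> M" by (simp add: type_ring_def)
  then have "M = carrier type_ring" using ideal.one_imp_carrier[OF id] by blast
  then show False using maximalideal.I_notcarr[OF M(1)] by blast
qed

text \<open>Trace 1 and determinant 0 make \<open>2E - I\<close> an involution. Its square supplies
  the factor \<open>1 = s * s + 4 * (b * c)\<close>, which replaces division, so the identity holds
  even where 2 is zero or a zero divisor.\<close>

lemma discriminant_commuting_idempotent:
  fixes A E :: "'a::comm_ring_1^2^2"
  assumes tr: "trace E = 1" and det: "det E = 0" and comm: "E ** A = A ** E"
  shows "(trace A)\<^sup>2 - 4 * det A = (2 * trace (E ** A) - trace A)\<^sup>2"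
proof -
  \<comment> \<open>The rows of \<open>E\<close> are \<open>(a, b)\<close> and
    \<open>(c, d)\<close>, those of \<open>A\<close> are \<open>(x, y)\<close> and
    \<open>(z, v)\<close>; the last three premises are entries of
    \<open>E ** A = A ** E\<close>.\<close>
  have poly: "(x + v)\<^sup>2 - 4 * (x * v - y * z) = (2 * (a * x + b * z + (c * y + d * v)) - (x + v))\<^sup>2"
    if "a + d = 1" "a * d - b * c = 0" "b * z = y * c" "a * y + b * v = x * b + y * d"
      "c * x + d * z = z * a + v * c"
    for a b c d x y z v :: 'a
  proof -
    \<comment> \<open>As \<open>a + d = 1\<close>, \<open>s\<close> is the diagonal difference
      \<open>a - d\<close> of \<open>E\<close>; \<open>t\<close> is that of
      \<open>A\<close>.\<close>
    define s where "s = 2 * a - 1"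
    define t where "t = x - v"
    have d: "d = 1 - a" using that(1) by (simp add: algebra_simps)
    have "s * s + 4 * (b * c) = 1 - 4 * (a * d - b * c)"
      unfolding s_def d by (simp add: algebra_simps)
    then have s: "s * s + 4 * (b * c) = 1"
      using that(2) by simp
    have y: "s * y = b * t" and z: "s * z = c * t"
      using that(4,5) unfolding s_def t_def d by (simp_all add: algebra_simps)
    have "t * t = t * t * (s * s + 4 * (b * c))"
      using s by simp
    also have "\<dots> = s * s * (t * t) + 4 * (b * t * (c * t))"
      by (simp add: algebra_simps)
    \<comment> \<open>Writing \<open>c * t\<close> as \<open>s * z\<close> gives the same mixed term
      as in \<open>y * z\<close> below, so the two add up to the cross term of the square.\<close>
    finally have tt: "t * t = s * s * (t * t) + 4 * (b * t * (s * z))"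
      by (simp only: z)
    have "y * z = y * z * (s * s + 4 * (b * c))"
      using s by simp
    also have "\<dots> = s * y * (s * z) + 4 * (y * c * (b * z))"
      by (simp add: algebra_simps)
    also have "\<dots> = b * t * (s * z) + 4 * (b * z * (b * z))"
      by (simp only: y that(3))
    finally have sq: "t * t + 4 * (y * z) = (s * t + 4 * (b * z))\<^sup>2"
      by (subst tt) (simp add: power2_eq_square algebra_simps)
    have u: "2 * (a * x + b * z + (c * y + d * v)) - (x + v) = s * t + 4 * (b * z)"
      using that(3) unfolding s_def t_def d by (simp add: algebra_simps)
    have disc: "(x + v)\<^sup>2 - 4 * (x * v - y * z) = t * t + 4 * (y * z)"
      unfolding t_def by (simp add: power2_eq_square algebra_simps)
    show ?thesis unfolding u disc by (fact sq)
  qed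
  have "E$1$1 + E$2$2 = 1" "E$1$1 * E$2$2 - E$1$2 * E$2$1 = 0"
    using tr det by (simp_all add: trace_def sum_2 det_2)
  moreover have "(E ** A) $ i $ j = (A ** E) $ i $ j" for i j
    using comm by simp
  from this[of 1 1] this[of 1 2] this[of 2 1]
  have "E$1$2 * A$2$1 = A$1$2 * E$2$1"
    "E$1$1 * A$1$2 + E$1$2 * A$2$2 = A$1$1 * E$1$2 + A$1$2 * E$2$2"
    "E$2$1 * A$1$1 + E$2$2 * A$2$1 = A$2$1 * E$1$1 + A$2$2 * E$2$1"
    unfolding matrix_matrix_mult_def sum_2 vec_lambda_beta
    by (simp_all add: mult.commute[of "A$1$1" "E$1$1"])
  ultimately show ?thesis
    unfolding trace_def det_2 sum_2 matrix_matrix_mult_def vec_lambda_beta by (rule poly)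
qed

text \<open>Locality is applied twice: \<open>det E\<close> is idempotent, and when it vanishes so
  is \<open>trace E\<close>. Determinant 1 makes \<open>E\<close> invertible, hence the identity;
  trace and determinant both 0 force \<open>E = 0\<close>.\<close>

lemma idempotent_matrix_2_cases:
  fixes E :: "'a::comm_ring_1^2^2"
  assumes loc: "commutative_local_ring (type_ring :: 'a ring)" and E: "E ** E = E"
  shows "E = 0 \<or> E = mat 1 \<or> (trace E = 1 \<and> det E = 0)"
proof -
  have ent: "E$1$1 * E$1$1 + E$1$2 * E$2$1 = E$1$1" "E$1$1 * E$1$2 + E$1$2 * E$2$2 = E$1$2"
    "E$2$1 * E$1$1 + E$2$2 * E$2$1 = E$2$1" "E$2$1 * E$1$2 + E$2$2 * E$2$2 = E$2$2"
    using E by (simp_all add: vec_eq_iff matrix_matrix_mult_def forall_2 sum_2)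
  have "det E * det E = det E"
    using det_mul[of E E] E by simp
  then consider "det E = 1" | "det E = 0"
    using commutative_local_ring_idempotent[OF loc] by blast
  then show ?thesis
  proof cases
    case 1
    \<comment> \<open>\<open>C\<close> is the adjugate of \<open>E\<close>, a left inverse here;
      multiplying \<open>E ** E = E\<close> by it gives \<open>E = mat 1\<close>.\<close>
    define C :: "'a^2^2" where
      "C = vector [vector [E$2$2, - E$1$2], vector [- E$2$1, E$1$1]]"
    have "C ** E = mat 1"
      using 1 by (simp add: C_def det_2 vec_eq_iff forall_2 matrix_matrix_mult_def sum_2 mat_def algebra_simps)
    then have "E = mat 1"
      by (metis E matrix_mul_assoc matrix_mul_lid)
    then show ?thesis by simp
  next
    case 2
    have "trace E * trace E = trace E"
    proof -
      have "trace E * trace E = trace (E ** E) + 2 * det E"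
        by (simp add: trace_def sum_2 det_2 matrix_matrix_mult_def algebra_simps)
      with E 2 show ?thesis by simp
    qed
    then consider "trace E = 1" | "trace E = 0"
      using commutative_local_ring_idempotent[OF loc] by blast
    then show ?thesis
    proof cases
      case 2
      then have tr: "E$2$2 = - E$1$1"
        by (simp add: trace_def sum_2 eq_neg_iff_add_eq_0 add.commute)
      \<comment> \<open>With trace 0 the off-diagonal entries of \<open>E ** E\<close>
        vanish.\<close>
      have "E$1$2 = 0" "E$2$1 = 0"
        using ent(2,3) by (simp_all add: tr algebra_simps)
      moreover from this have "E$1$1 = 0"
        using ent(1) \<open>det E = 0\<close> by (simp add: det_2 tr)
      ultimately have "E = 0"
        by (simp add: tr vec_eq_iff forall_2)
      then show ?thesis by simp
    qed (use \<open>det E = 0\<close> in simp)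
  qed
qed

theorem theorem5p1:
  fixes A :: "'a::comm_ring_1^2^2"
  assumes "commutative_local_ring (type_ring :: 'a ring)"
    and "strongly_P_clean M2_ring A"
  shows "A \<in> M2_over (prime_radical type_ring)
    \<or> mat 1 - A \<in> M2_over (prime_radical type_ring)
    \<or> (trace A \<in> (+) 1 ` prime_radical type_ring
        \<and> (\<exists>u \<in> (+) 1 ` prime_radical type_ring. (trace A)\<^sup>2 - 4 * det A = u\<^sup>2))"
proof -
  let ?P = "prime_radical (type_ring :: 'a ring)"
  obtain E W where E: "E ** E = E" and W: "W \<in> prime_radical M2_ring"
    and comm: "E ** W = W ** E" and A: "A = E + W"
    using assms(2) by (auto simp: strongly_P_clean_def M2_ring_def)
  have ent: "W $ i $ j \<in> ?P" for i j
    using prime_radical_M2_ring_subset W by (auto simp: M2_over_def)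
  have add: "x + y \<in> ?P" if "x \<in> ?P" "y \<in> ?P" for x y
    using ideal_prime_radical_type_ring that unfolding ideal_type_ring_iff by blast
  have mult: "r * x \<in> ?P" if "x \<in> ?P" for r x
    using ideal_prime_radical_type_ring that unfolding ideal_type_ring_iff by blast
  have neg: "- x \<in> ?P" if "x \<in> ?P" for x
    using mult[OF that, of "- 1"] by simp
  consider "E = 0" | "E = mat 1" | "trace E = 1" "det E = 0"
    using idempotent_matrix_2_cases[OF assms(1) E] by blast
  then show ?thesis
  proof cases
    case 1
    then show ?thesis using A ent by (simp add: M2_over_def)
  next
    case 2
    then show ?thesis using A ent neg by (simp add: M2_over_def)
  next
    case 3
    have trW: "trace W \<in> ?P" and trEW: "trace (E ** W) \<in> ?P"
      by (auto simp: trace_def matrix_matrix_mult_def sum_2 intro!: add mult ent)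
    have EA: "E ** A = E + E ** W" and AE: "A ** E = E + W ** E"
      using E A by (simp_all add: matrix_add_ldistrib matrix_matrix_mult_def vec_eq_iff sum_2 algebra_simps)
    \<comment> \<open>This is the root \<open>u\<close>: since \<open>trace E = 1\<close>, the part
      \<open>E\<close> of \<open>A\<close> contributes \<open>2 - 1\<close>, and \<open>W\<close>
      contributes only elements of the radical.\<close>
    have "2 * trace (E ** A) - trace A = 1 + (2 * trace (E ** W) + - trace W)"
      using 3(1) EA A by (simp add: trace_add algebra_simps)
    then have "2 * trace (E ** A) - trace A \<in> (+) 1 ` ?P"
      using add[OF mult[OF trEW] neg[OF trW]] by auto
    moreover have "trace A \<in> (+) 1 ` ?P"
      using 3(1) A trW by (simp add: trace_add)
    moreover have "E ** A = A ** E" using EA AE comm by simp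
    ultimately show ?thesis
      using discriminant_commuting_idempotent[OF 3] by blast
  qed
qed

end
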